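(* Let $X$ be a smooth complete toric variety of dimension $d\ge5$ over an algebraically closed field with Picard number $\rho(X)=2$. Then $\mathrm{ch}_4(X)$ is not positive.
   Context: For a smooth complete toric variety $X$ of dimension $d$ with torus invariant prime divisors $D_1,\dots,D_n$, $\mathrm{ch}_k(X)=\frac{1}{k!}\sum_i D_i^k$. For $1\le k\le d$, $\mathrm{ch}_k(X)$ is positive if $(\mathrm{ch}_k(X)\cdot Y)>0$ for every $k$-dimensional torus invariant irreducible closed subvariety $Y\subset X$. *)

theory Defs
  imports "HOL-Analysis.Analysis" "HOL-Library.Multiset"
begin

text \<open>A smooth complete toric variety X of dimension d = CARD('d) is encoded by its fan:
  rays v 0, ..., v (n-1) in the lattice N = Z^d (type int^'d), and the fan F given as the
  set of index sets of the rays spanning its cones (smooth fans are simplicial).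
  The torus invariant prime divisors are D_0, ..., D_(n-1), D_i corresponding to v i.\<close>

definition toric_pair :: "int^'d \<Rightarrow> int^'d \<Rightarrow> int" where
  "toric_pair m u = (\<Sum>k\<in>UNIV. m $ k * u $ k)"

definition rcone :: "(nat \<Rightarrow> int^'d) \<Rightarrow> nat set \<Rightarrow> (real^'d) set" where
  "rcone v S = {x. \<exists>c. (\<forall>i\<in>S. c i \<ge> 0) \<and>
      x = (\<Sum>i\<in>S. c i *\<^sub>R (\<chi> k. real_of_int (v i $ k)))}"

definition smooth_complete_fan :: "nat \<Rightarrow> (nat \<Rightarrow> int^'d) \<Rightarrow> nat set set \<Rightarrow> bool" where
  "smooth_complete_fan n v F \<longleftrightarrow>
     (\<forall>S\<in>F. S \<subseteq> {..<n}) \<and>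
     (\<forall>i<n. {i} \<in> F) \<and>
     inj_on v {..<n} \<and>
     (\<forall>S\<in>F. \<forall>T. T \<subseteq> S \<longrightarrow> T \<in> F) \<and>
     (\<forall>S\<in>F. \<forall>T\<in>F. rcone v S \<inter> rcone v T = rcone v (S \<inter> T)) \<and>
     (\<forall>S\<in>F. \<exists>B::int^'d^'d. (det B = 1 \<or> det B = -1) \<and> (\<forall>i\<in>S. \<exists>k. row k B = v i)) \<and>
     (\<Union>S\<in>F. rcone v S) = UNIV"

text \<open>deg M is the intersection number of the product of the divisors D_i (with multiplicity
  count M i) for a multiset M of size d.  These axioms (Stanley--Reisner relations, linear
  relations, normalisation on maximal smooth cones) determine deg uniquely.\<close>

definition toric_degree :: "nat \<Rightarrow> (nat \<Rightarrow> int^'d) \<Rightarrow> nat set set \<Rightarrow> (nat multiset \<Rightarrow> rat) \<Rightarrow> bool" where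
  "toric_degree n v F deg \<longleftrightarrow>
     (\<forall>M. size M = CARD('d) \<and> set_mset M \<subseteq> {..<n} \<and> set_mset M \<notin> F \<longrightarrow> deg M = 0) \<and>
     (\<forall>S\<in>F. card S = CARD('d) \<longrightarrow> deg (mset_set S) = 1) \<and>
     (\<forall>m M. size M = CARD('d) - 1 \<and> set_mset M \<subseteq> {..<n} \<longrightarrow>
        (\<Sum>j<n. of_int (toric_pair m (v j)) * deg (add_mset j M)) = 0)"

text \<open>(ch_k(X) . V(tau)) = 1/k! * sum_i (D_i^k . V(tau)), and the k-dimensional torus invariant
  irreducible closed subvarieties are the V(tau) for cones tau with d - k rays.\<close>

definition ch_positive :: "nat \<Rightarrow> (nat \<Rightarrow> int^'d) \<Rightarrow> nat set set \<Rightarrow> (nat multiset \<Rightarrow> rat) \<Rightarrow> nat \<Rightarrow> bool" where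
  "ch_positive n v F deg k \<longleftrightarrow>
     (\<forall>\<tau>\<in>F. card \<tau> = CARD('d) - k \<longrightarrow>
        (1 / fact k) * (\<Sum>i<n. deg (replicate_mset k i + mset_set \<tau>)) > 0)"

end

theory Submission
  imports Defs
begin

text \<open>
  Crossing a wall of a maximal cone replaces one ray by one of the two missing rays, so the pairs of
  rays complementary to the maximal cones form a complete bipartite graph with parts P and Q. Up to
  exchanging P and Q, the divisors indexed by Q share one class H and those indexed by P have classes
  \<xi> - a i H, as on a projective bundle over a projective space; intersection numbers are then explicit.

  Take \<tau> to be the complement of I \<union> J with I \<subseteq> P consisting of the indices with the smallest a.
  If |Q| \<ge> 4, take |I| = 2 and |J| = 4: with I = {i, j} the index k \<in> P contributes
  (e + c)(e^2 + c^2) for e = a i - a k and c = a j - a k. If |P| \<ge> 4, take |I| = 4 and |J| = 2: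
  k \<in> P contributes the sum of a i - a k over I. In both cases Q contributes 0, the contributions
  of I cancel, and those of P - I are nonpositive by the choice of I.
\<close>

section \<open>Integral dual bases\<close>

text \<open>Cramer's rule: as \<open>det B\<close> is 1 or -1, dividing by it amounts to multiplying
  by it, so the inverse has integer entries. The matrix identities are checked over the reals and
  pulled back to the integers.\<close>

lemma unimodular_inverse:
  fixes B :: "int^'d^'d"
  assumes "det B = 1 \<or> det B = -1"
  shows "\<exists>C. B ** C = mat 1 \<and> C ** B = mat 1"
proof -
  define R :: "real^'d^'d" where "R = (\<chi> i j. real_of_int (B $ i $ j))"
  have det_of_int: "det (\<chi> i j. real_of_int (A $ i $ j)) = real_of_int (det A)" for A :: "int^'d^'d"
    by (simp add: det_def)
  have det_R: "det R = 1 \<or> det R = -1"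
    using assms unfolding R_def det_of_int by auto
  define C :: "int^'d^'d" where
    "C = (\<chi> k l. det B * det (\<chi> i j. if j = k then (if i = l then 1 else 0) else B $ i $ j))"
  define RC :: "real^'d^'d" where "RC = (\<chi> i j. real_of_int (C $ i $ j))"
  have RC: "column l RC = (\<chi> k. det (\<chi> i j. if j = k then axis l 1 $ i else R $ i $ j) / det R)" for l
  proof -
    have "real_of_int (det (\<chi> i j. if j = k then (if i = l then 1 else 0) else B $ i $ j))
        = det (\<chi> i j. if j = k then axis l 1 $ i else R $ i $ j)" for k
      by (subst det_of_int[symmetric]) (auto intro!: arg_cong[where f = det] simp: vec_eq_iff R_def axis_def)
    then show ?thesis
      using det_R det_of_int[of B]
      by (auto simp: vec_eq_iff column_def RC_def C_def R_def)
  qed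
  have "R *v column l RC = axis l 1" for l
    using cramer[of R "column l RC" "axis l 1"] det_R RC by auto
  then have R1: "R ** RC = mat 1"
    by (simp add: vec_eq_iff matrix_matrix_mult_def matrix_vector_mult_def column_def mat_def axis_def)
  then have R2: "RC ** R = mat 1"
    by (simp add: matrix_left_right_inverse)
  have "real_of_int ((B ** C) $ i $ j) = real_of_int (mat 1 $ i $ j)" for i j
    using R1 by (simp add: vec_eq_iff matrix_matrix_mult_def R_def RC_def mat_def)
  moreover have "real_of_int ((C ** B) $ i $ j) = real_of_int (mat 1 $ i $ j)" for i j
    using R2 by (simp add: vec_eq_iff matrix_matrix_mult_def R_def RC_def mat_def)
  ultimately show ?thesis
    by (intro exI[of _ C]) (simp add: vec_eq_iff)
qed

section \<open>Linearity of the lattice pairing and dual vectors\<close>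

lemma toric_pair_add: "toric_pair m (x + y) = toric_pair m x + toric_pair m y"
  by (simp add: toric_pair_def algebra_simps sum.distrib)

lemma toric_pair_diff: "toric_pair m (x - y) = toric_pair m x - toric_pair m y"
  by (simp add: toric_pair_def algebra_simps sum_subtractf)

lemma toric_pair_minus: "toric_pair m (- x) = - toric_pair m x"
  by (simp add: toric_pair_def sum_negf)

lemma toric_pair_smult: "toric_pair m (c *s x) = c * toric_pair m x"
  by (simp add: toric_pair_def sum_distrib_left algebra_simps)

lemma toric_pair_zero: "toric_pair m 0 = 0"
  by (simp add: toric_pair_def)

lemma toric_pair_sum: "toric_pair m (\<Sum>i\<in>S. f i) = (\<Sum>i\<in>S. toric_pair m (f i))"
  by (induction S rule: infinite_finite_induct) (auto simp: toric_pair_zero toric_pair_add)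

lemmas toric_pair_linear =
  toric_pair_add toric_pair_diff toric_pair_minus toric_pair_smult toric_pair_zero toric_pair_sum

lemma toric_pair_dual_sum:
  assumes "finite S" "i \<in> S" "\<And>j. j \<in> S \<Longrightarrow> toric_pair m (v j) = (if i = j then 1 else 0)"
  shows "toric_pair m (\<Sum>j\<in>S. c j *s v j) = c i"
proof -
  have "toric_pair m (\<Sum>j\<in>S. c j *s v j) = (\<Sum>j\<in>S. if i = j then c j else 0)"
    unfolding toric_pair_sum by (intro sum.cong) (auto simp: toric_pair_smult assms(3))
  then show ?thesis
    using assms(1,2) by simp
qed

definition dual_on :: "(nat \<Rightarrow> int^'d) \<Rightarrow> nat set \<Rightarrow> (nat \<Rightarrow> int^'d) \<Rightarrow> bool" where
  "dual_on v S m \<longleftrightarrow> (\<forall>i\<in>S. \<forall>j\<in>S. toric_pair (m i) (v j) = (if i = j then 1 else 0))"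

section \<open>Wall crossing in smooth complete fans\<close>

text \<open>For cones of a smooth fan these are all the lattice points of the real cone
  (\<open>rcone_of_int_iff\<close>), so the fan can be studied with integer coordinates
  only.\<close>

definition int_cone :: "(nat \<Rightarrow> int^'d) \<Rightarrow> nat set \<Rightarrow> (int^'d) set" where
  "int_cone v S = {x. \<exists>c. (\<forall>i\<in>S. c i \<ge> 0) \<and> x = (\<Sum>i\<in>S. c i *s v i)}"

lemma int_coneI: "(\<And>i. i \<in> S \<Longrightarrow> c i \<ge> 0) \<Longrightarrow> x = (\<Sum>i\<in>S. c i *s v i) \<Longrightarrow> x \<in> int_cone v S"
  by (auto simp: int_cone_def)

lemma int_coneE:
  assumes "x \<in> int_cone v S"
  obtains c where "\<And>i. i \<in> S \<Longrightarrow> c i \<ge> 0" "x = (\<Sum>i\<in>S. c i *s v i)"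
  using assms by (auto simp: int_cone_def)

locale toric_fan =
  fixes n :: nat and v :: "nat \<Rightarrow> int^'d" and F :: "nat set set"
  assumes fan: "smooth_complete_fan n v F"
begin

lemma cone_subset: "S \<in> F \<Longrightarrow> S \<subseteq> {..<n}"
  and ray_cone: "i < n \<Longrightarrow> {i} \<in> F"
  and inj_rays: "inj_on v {..<n}"
  and face_closed: "S \<in> F \<Longrightarrow> T \<subseteq> S \<Longrightarrow> T \<in> F"
  and rcone_Int: "S \<in> F \<Longrightarrow> T \<in> F \<Longrightarrow> rcone v S \<inter> rcone v T = rcone v (S \<inter> T)"
  and unimodular_cone:
    "S \<in> F \<Longrightarrow> \<exists>B :: int^'d^'d. (det B = 1 \<or> det B = -1) \<and> (\<forall>i\<in>S. \<exists>k. row k B = v i)"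
  and rcone_cover: "(\<Union>S\<in>F. rcone v S) = UNIV"
  using fan by (simp_all add: smooth_complete_fan_def)

lemma finite_cone: "S \<in> F \<Longrightarrow> finite S"
  using cone_subset finite_subset by blast

lemma finite_fan: "finite F"
  by (rule finite_subset[of _ "Pow {..<n}"]) (auto dest: cone_subset)

section \<open>Lattice bases through the rays of a cone\<close>

lemma unimodular_frame:
  assumes "S \<in> F"
  obtains B C :: "int^'d^'d" and f where "inj_on f S" "\<And>i. i \<in> S \<Longrightarrow> row (f i) B = v i"
    "B ** C = mat 1" "C ** B = mat 1"
proof -
  obtain B :: "int^'d^'d" where B: "det B = 1 \<or> det B = -1" "\<forall>i\<in>S. \<exists>k. row k B = v i"
    using unimodular_cone[OF assms] by blast
  then obtain f where f: "\<And>i. i \<in> S \<Longrightarrow> row (f i) B = v i"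
    by metis
  have "inj_on f S"
    by (rule inj_onI) (metis assms cone_subset f inj_onD inj_rays subsetD)
  then show thesis
    using unimodular_inverse[OF B(1)] f that by blast
qed

lemma toric_pair_row_column:
  "toric_pair (column k C) (row l B) = (B ** C) $ l $ k" for B C :: "int^'d^'d"
  by (simp add: toric_pair_def row_def column_def matrix_matrix_mult_def mult.commute)

text \<open>The columns of the inverse of a unimodular matrix are dual to its rows.\<close>

lemma dual_basis:
  assumes "S \<in> F"
  obtains m where "dual_on v S m"
proof -
  obtain B C :: "int^'d^'d" and f where *: "inj_on f S" "\<And>i. i \<in> S \<Longrightarrow> row (f i) B = v i" "B ** C = mat 1"
    using unimodular_frame[OF assms] by metis
  have "toric_pair (column (f i) C) (v j) = (if i = j then 1 else 0)" if "i \<in> S" "j \<in> S" for i j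
    using that toric_pair_row_column[of "f i" C "f j" B] *
    by (auto simp: mat_def inj_on_eq_iff)
  then show thesis
    by (intro that[of "\<lambda>i. column (f i) C"]) (simp add: dual_on_def)
qed

lemma card_cone_le: "S \<in> F \<Longrightarrow> card S \<le> CARD('d)"
  by (metis card_image card_mono finite_class.finite_UNIV subset_UNIV unimodular_frame)

lemma independent_direction:
  assumes "S \<in> F" "card S < CARD('d)"
  obtains m y :: "int^'d" where "toric_pair m y = 1" "\<And>i. i \<in> S \<Longrightarrow> toric_pair m (v i) = 0"
proof -
  obtain B C :: "int^'d^'d" and f where *: "inj_on f S" "\<And>i. i \<in> S \<Longrightarrow> row (f i) B = v i" "B ** C = mat 1"
    using unimodular_frame[OF assms(1)] by metis
  have "f ` S \<noteq> UNIV"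
    using assms(2) *(1) by (metis card_image less_irrefl)
  then obtain k where "k \<notin> f ` S"
    by blast
  then have "toric_pair (column k C) (v i) = 0" if "i \<in> S" for i
    using toric_pair_row_column[of k C "f i" B] * that by (auto simp: mat_def)
  then show thesis
    using toric_pair_row_column[of k C k B] *
    by (intro that[of "column k C" "row k B"]) (auto simp: mat_def)
qed

text \<open>For a maximal cone every row of \<open>B\<close> is a ray, and multiplying
  \<open>x\<close> by \<open>C ** B = mat 1\<close> spells out its coordinates.\<close>

lemma expansion:
  assumes "S \<in> F" "card S = CARD('d)"
  obtains m where "dual_on v S m" "\<And>x. x = (\<Sum>i\<in>S. toric_pair (m i) x *s v i)"
proof -
  obtain B C :: "int^'d^'d" and f where *: "inj_on f S" "\<And>i. i \<in> S \<Longrightarrow> row (f i) B = v i" "B ** C = mat 1"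
    and CB: "C ** B = mat 1"
    using unimodular_frame[OF assms(1)] by metis
  have "toric_pair (column (f i) C) (v j) = (if i = j then 1 else 0)" if "i \<in> S" "j \<in> S" for i j
    using that toric_pair_row_column[of "f i" C "f j" B] *
    by (auto simp: mat_def inj_on_eq_iff)
  moreover have surj: "f ` S = UNIV"
    by (rule card_subset_eq) (use assms(2) *(1) in \<open>auto simp: card_image\<close>)
  have "x = (\<Sum>i\<in>S. toric_pair (column (f i) C) x *s v i)" for x
  proof -
    have "x = x v* (C ** B)"
      by (simp add: CB)
    also have "\<dots> = (x v* C) v* B"
      by (simp add: vector_matrix_mul_assoc)
    also have "\<dots> = (\<Sum>k\<in>UNIV. toric_pair (column k C) x *s row k B)"
      by (auto simp: vec_eq_iff vector_matrix_mult_def toric_pair_def row_def column_def mult.commute)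
    also have "\<dots> = (\<Sum>i\<in>S. toric_pair (column (f i) C) x *s row (f i) B)"
      unfolding surj[symmetric] using *(1) by (simp add: sum.reindex)
    finally show ?thesis
      using *(2) by simp
  qed
  ultimately show thesis
    by (intro that[of "\<lambda>i. column (f i) C"]) (auto simp: dual_on_def)
qed

text \<open>The real coefficients of a lattice point are its pairings with the integral dual
  vectors, hence integers.\<close>

lemma rcone_of_int_iff:
  assumes "S \<in> F"
  shows "(\<chi> k. real_of_int (x $ k)) \<in> rcone v S \<longleftrightarrow> x \<in> int_cone v S"
proof
  assume "(\<chi> k. real_of_int (x $ k)) \<in> rcone v S"
  then obtain c where c: "\<forall>i\<in>S. c i \<ge> 0"
    "(\<chi> k. real_of_int (x $ k)) = (\<Sum>i\<in>S. c i *\<^sub>R (\<chi> k. real_of_int (v i $ k)))"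
    unfolding rcone_def by blast
  have x: "real_of_int (x $ k) = (\<Sum>i\<in>S. c i * real_of_int (v i $ k))" for k
    using arg_cong[OF c(2), of "\<lambda>y. y $ k"] by simp
  obtain m where m: "dual_on v S m"
    using dual_basis[OF assms] .
  have ci: "c i = real_of_int (toric_pair (m i) x)" if "i \<in> S" for i
  proof -
    have "real_of_int (toric_pair (m i) x) = (\<Sum>k\<in>UNIV. \<Sum>j\<in>S. c j * (m i $ k * v j $ k))"
      by (simp add: toric_pair_def x sum_distrib_left mult_ac)
    also have "\<dots> = (\<Sum>j\<in>S. c j * real_of_int (toric_pair (m i) (v j)))"
      by (subst sum.swap) (simp add: toric_pair_def sum_distrib_left)
    also have "\<dots> = (\<Sum>j\<in>S. if i = j then c j else 0)"
      by (intro sum.cong) (use m that in \<open>auto simp: dual_on_def\<close>)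
    finally show ?thesis
      using that finite_cone[OF assms] by simp
  qed
  have "real_of_int (x $ k) = real_of_int ((\<Sum>i\<in>S. toric_pair (m i) x *s v i) $ k)" for k
    by (simp add: x ci)
  then have "x = (\<Sum>i\<in>S. toric_pair (m i) x *s v i)"
    unfolding of_int_eq_iff vec_eq_iff by blast
  then show "x \<in> int_cone v S"
    using c(1) ci by (intro int_coneI[where c = "\<lambda>i. toric_pair (m i) x"]) auto
next
  assume "x \<in> int_cone v S"
  then obtain c where c: "\<forall>i\<in>S. c i \<ge> 0" "x = (\<Sum>i\<in>S. c i *s v i)"
    unfolding int_cone_def by blast
  show "(\<chi> k. real_of_int (x $ k)) \<in> rcone v S"
    unfolding rcone_def using c(1)
    by (auto intro!: exI[of _ "\<lambda>i. real_of_int (c i)"] simp: vec_eq_iff c(2))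
qed

section \<open>Enlarging cones\<close>

lemma int_cone_cover: "\<exists>S\<in>F. x \<in> int_cone v S"
  using rcone_cover rcone_of_int_iff by blast

lemma int_cone_Int:
  assumes "S \<in> F" "T \<in> F" "x \<in> int_cone v S" "x \<in> int_cone v T"
  shows "x \<in> int_cone v (S \<inter> T)"
proof -
  have "S \<inter> T \<in> F"
    using face_closed[OF assms(1)] by blast
  then show ?thesis
    using rcone_Int[OF assms(1,2)] assms by (simp add: rcone_of_int_iff[symmetric]) blast
qed

text \<open>The sum \<open>w\<close> of the rays of \<open>S\<close> is interior to its cone, so
  \<open>M *s w + y\<close> for large \<open>M\<close> models a small step from there towards
  \<open>y\<close>. As \<open>F\<close> is finite, one cone \<open>T\<close> contains this point for
  infinitely many \<open>M\<close>; it must contain \<open>w\<close>, and therefore all of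
  \<open>S\<close>.\<close>

lemma extend_cone:
  assumes S: "S \<in> F"
  obtains T M where "T \<in> F" "S \<subseteq> T" "M *s (\<Sum>i\<in>S. v i) + y \<in> int_cone v T"
proof -
  define w where "w = (\<Sum>i\<in>S. v i)"
  define g where "g M = (SOME T. T \<in> F \<and> int M *s w + y \<in> int_cone v T)" for M
  have g: "g M \<in> F" "int M *s w + y \<in> int_cone v (g M)" for M
  proof -
    have "\<exists>T. T \<in> F \<and> int M *s w + y \<in> int_cone v T"
      using int_cone_cover by blast
    then have "g M \<in> F \<and> int M *s w + y \<in> int_cone v (g M)"
      unfolding g_def by (rule someI_ex)
    then show "g M \<in> F" "int M *s w + y \<in> int_cone v (g M)"
      by auto
  qed
  have "finite (range g)"
    using g(1) finite_fan by (meson finite_subset image_subsetI)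
  then obtain M0 where inf: "infinite {M. g M = g M0}"
    using pigeonhole_infinite[of UNIV g] by auto
  define T where "T = g M0"
  have T: "T \<in> F"
    by (simp add: T_def g)
  obtain m where m: "dual_on v T m"
    using dual_basis[OF T] .
  have coords: "x = (\<Sum>i\<in>T. toric_pair (m i) x *s v i)" "\<forall>i\<in>T. toric_pair (m i) x \<ge> 0"
    if x: "x \<in> int_cone v T" for x
  proof -
    obtain c where c: "\<forall>i\<in>T. c i \<ge> 0" "x = (\<Sum>i\<in>T. c i *s v i)"
      using x by (auto elim: int_coneE)
    have "toric_pair (m i) x = c i" if "i \<in> T" for i
      using toric_pair_dual_sum[of T i "m i" v c] that m finite_cone[OF T] c(2)
      by (auto simp: dual_on_def)
    then show "x = (\<Sum>i\<in>T. toric_pair (m i) x *s v i)" "\<forall>i\<in>T. toric_pair (m i) x \<ge> 0"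
      using c by auto
  qed
  have inT: "int M *s w + y \<in> int_cone v T" if "g M = g M0" for M
    using g(2)[of M] that T_def by simp
  have large: "\<exists>M > K. g M = g M0" for K
    using inf by (metis (mono_tags, lifting) infinite_nat_iff_unbounded mem_Collect_eq)
  obtain M1 where M1: "M1 > M0" "g M1 = g M0"
    using large by blast
  \<comment> \<open>Two of these points of \<open>T\<close> differ by a nonzero multiple of
    \<open>w\<close>, and the factor cancels.\<close>
  have span: "w = (\<Sum>i\<in>T. toric_pair (m i) w *s v i)"
  proof -
    have "int (M1 - M0) *s w = (int M1 *s w + y) - (int M0 *s w + y)"
      using M1(1) by (simp add: of_nat_diff vector_sub_rdistrib less_imp_le)
    also have "\<dots> = (\<Sum>i\<in>T. toric_pair (m i) (int M1 *s w + y) *s v i) - (\<Sum>i\<in>T. toric_pair (m i) (int M0 *s w + y) *s v i)"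
      using coords(1)[OF inT[OF M1(2)]] coords(1)[OF inT[OF refl]] by simp
    also have "\<dots> = (\<Sum>i\<in>T. int (M1 - M0) *s (toric_pair (m i) w *s v i))"
      unfolding sum_subtractf[symmetric] using M1(1)
      by (intro sum.cong refl) (simp add: vec_eq_iff toric_pair_linear of_nat_diff less_imp_le algebra_simps)
    also have "\<dots> = int (M1 - M0) *s (\<Sum>i\<in>T. toric_pair (m i) w *s v i)"
      by (simp add: vec_eq_iff sum_distrib_left mult.assoc)
    finally have eq: "int (M1 - M0) * w $ k = int (M1 - M0) * (\<Sum>i\<in>T. toric_pair (m i) w *s v i) $ k" for k
      by (metis vector_smult_component)
    have nz: "int (M1 - M0) \<noteq> 0"
      using M1(1) by simp
    show ?thesis
      using eq unfolding mult_left_cancel[OF nz] vec_eq_iff by blast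
  qed
  \<comment> \<open>For large \<open>M\<close> a negative coordinate of \<open>w\<close> would
    outweigh that of \<open>y\<close>.\<close>
  have "toric_pair (m i) w \<ge> 0" if "i \<in> T" for i
  proof (rule ccontr)
    assume "\<not> toric_pair (m i) w \<ge> 0"
    then have neg: "toric_pair (m i) w \<le> -1"
      by simp
    obtain M where M: "M > nat \<bar>toric_pair (m i) y\<bar>" "g M = g M0"
      using large by blast
    have "0 \<le> int M * toric_pair (m i) w + toric_pair (m i) y"
      using coords(2)[OF inT[OF M(2)]] that by (simp add: toric_pair_linear)
    moreover have "int M * toric_pair (m i) w \<le> int M * (-1)"
      using neg by (intro mult_left_mono) auto
    ultimately show False
      using M(1) by linarith
  qed
  then have "w \<in> int_cone v T"
    using span by (intro int_coneI) auto
  moreover have "w \<in> int_cone v S"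
    by (rule int_coneI[where c = "\<lambda>_. 1"]) (auto simp: w_def)
  ultimately obtain c where c: "w = (\<Sum>i\<in>S \<inter> T. c i *s v i)"
    using int_cone_Int[OF S T] by (auto elim: int_coneE)
  obtain m' where m': "dual_on v S m'"
    using dual_basis[OF S] .
  \<comment> \<open>The coordinates of \<open>w\<close> along \<open>S\<close> are all 1, yet
    \<open>w\<close> is a combination of rays in \<open>S \<inter> T\<close>, so no ray of
    \<open>S\<close> is missing from \<open>T\<close>.\<close>
  have "S \<subseteq> T"
  proof
    fix i assume i: "i \<in> S"
    have "toric_pair (m' i) w = 1"
      using toric_pair_dual_sum[of S i "m' i" v "\<lambda>_. 1"] i m' finite_cone[OF S]
      by (auto simp: dual_on_def w_def)
    show "i \<in> T"
    proof (rule ccontr)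
      assume "i \<notin> T"
      then have "toric_pair (m' i) w = 0"
        unfolding c toric_pair_sum
        by (intro sum.neutral) (use m' i in \<open>auto simp: dual_on_def toric_pair_smult\<close>)
      then show False
        using \<open>toric_pair (m' i) w = 1\<close> by simp
    qed
  qed
  with T show thesis
    using that inT[of M0] unfolding w_def by blast
qed

text \<open>Stepping in a direction outside the span of \<open>S\<close> forces a strictly larger
  cone; repeat until the dimension is reached.\<close>

lemma extend_to_maximal:
  assumes "S \<in> F"
  obtains T where "T \<in> F" "S \<subseteq> T" "card T = CARD('d)"
proof -
  have "\<exists>T\<in>F. S \<subseteq> T \<and> card T = CARD('d)"
    using assms
  proof (induction "CARD('d) - card S" arbitrary: S rule: less_induct)
    case less
    show ?case
    proof (cases "card S = CARD('d)")
      case True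
      then show ?thesis
        using less.prems by blast
    next
      case False
      then have lt: "card S < CARD('d)"
        using card_cone_le[OF less.prems] by simp
      obtain m y :: "int^'d" where my: "toric_pair m y = 1" "\<And>i. i \<in> S \<Longrightarrow> toric_pair m (v i) = 0"
        using independent_direction[OF less.prems lt] by blast
      obtain T M where T: "T \<in> F" "S \<subseteq> T" "M *s (\<Sum>i\<in>S. v i) + y \<in> int_cone v T"
        using extend_cone[OF less.prems] .
      have "T \<noteq> S"
      proof
        assume "T = S"
        then obtain c where "M *s (\<Sum>i\<in>S. v i) + y = (\<Sum>i\<in>S. c i *s v i)"
          using T(3) unfolding int_cone_def by blast
        from arg_cong[OF this, of "toric_pair m"] show False
          by (simp add: toric_pair_linear my)
      qed
      then have "card S < card T"
        using T finite_cone by (metis psubsetI psubset_card_mono)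
      then have "\<exists>T'\<in>F. T \<subseteq> T' \<and> card T' = CARD('d)"
        using less.hyps[of T] lt T(1) by (meson diff_less_mono2)
      then show ?thesis
        using T(2) by blast
    qed
  qed
  then show thesis
    using that by blast
qed

text \<open>Otherwise adding a large multiple of the sum over the common facet to v j gives a point of both
  cones outside the facet.\<close>

lemma cones_over_facet_separated:
  assumes T: "insert j R \<in> F" "insert j' R \<in> F" and j: "j \<noteq> j'" "j \<notin> R" "j' \<notin> R"
  shows "v j \<noteq> v j' + (\<Sum>k\<in>R. c k *s v k)"
proof
  assume eq: "v j = v j' + (\<Sum>k\<in>R. c k *s v k)"
  have fin: "finite R"
    using finite_cone[OF T(1)] by simp
  define M where "M = (\<Sum>k\<in>R. \<bar>c k\<bar>)"
  have M: "0 \<le> M" "0 \<le> c k + M" if "k \<in> R" for k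
    using member_le_sum[of k R "\<lambda>k. \<bar>c k\<bar>"] that fin unfolding M_def by (auto intro: sum_nonneg)
  define x where "x = v j + (\<Sum>k\<in>R. M *s v k)"
  have "x \<in> int_cone v (insert j R)"
    by (rule int_coneI[where c = "\<lambda>k. if k = j then 1 else M"])
      (use fin j M in \<open>auto simp: x_def intro!: sum.cong\<close>)
  moreover have "x = v j' + (\<Sum>k\<in>R. (c k + M) *s v k)"
    by (simp add: x_def eq vector_sadd_rdistrib sum.distrib)
  then have "x \<in> int_cone v (insert j' R)"
    by (intro int_coneI[where c = "\<lambda>k. if k = j' then 1 else c k + M"])
      (use fin j M in \<open>auto intro!: sum.cong\<close>)
  moreover have "insert j R \<inter> insert j' R = R"
    using j by auto
  ultimately obtain c' where c': "x = (\<Sum>k\<in>R. c' k *s v k)"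
    using int_cone_Int[OF T, of x] by (metis int_coneE)
  obtain m where m: "dual_on v (insert j R) m"
    using dual_basis[OF T(1)] .
  have zero: "toric_pair (m j) (v k) = 0" if "k \<in> R" for k
    using m j that by (auto simp: dual_on_def)
  have "toric_pair (m j) (v j) = 1"
    using m by (auto simp: dual_on_def)
  then have "toric_pair (m j) x = 1"
    unfolding x_def by (simp add: toric_pair_linear zero)
  moreover have "toric_pair (m j) x = 0"
    unfolding c' by (simp add: toric_pair_linear zero)
  ultimately show False
    by simp
qed

text \<open>Both adjacent cones give lattice bases, so the coordinate across the wall is an integer
  with an integral inverse. The value 1 would place both cones on the same side of the wall.\<close>

lemma adjacent_coefficient:
  assumes S: "S \<in> F" "i \<in> S" and j: "j \<notin> S" "insert j (S - {i}) \<in> F"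
    and m: "dual_on v S m" "v j = (\<Sum>k\<in>S. toric_pair (m k) (v j) *s v k)"
    and S': "card S = CARD('d)"
  shows "toric_pair (m i) (v j) = -1"
proof -
  define R where "R = S - {i}"
  define a where "a = toric_pair (m i) (v j)"
  have R: "S = insert i R" "i \<notin> R" "j \<notin> R" "finite R"
    unfolding R_def using insert_Diff[OF S(2)] finite_cone[OF S(1)] j by simp_all
  have vj: "v j = a *s v i + (\<Sum>k\<in>R. toric_pair (m k) (v j) *s v k)"
    using m(2) R by (simp add: a_def)
  have T: "insert j R \<in> F"
    using j by (simp add: R_def)
  have cT: "card (insert j R) = CARD('d)"
    using S' R by simp
  obtain m' where m': "dual_on v (insert j R) m'" "\<And>x. x = (\<Sum>k\<in>insert j R. toric_pair (m' k) x *s v k)"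
    using expansion[OF T cT] by blast
  have "v i = toric_pair (m' j) (v i) *s v j + (\<Sum>k\<in>R. toric_pair (m' k) (v i) *s v k)"
    using m'(2)[of "v i"] R by simp
  from arg_cong[OF this, of "toric_pair (m i)"]
  have "toric_pair (m i) (v i) = toric_pair (m' j) (v i) * a + (\<Sum>k\<in>R. toric_pair (m' k) (v i) * toric_pair (m i) (v k))"
    by (simp add: toric_pair_linear a_def)
  moreover have "toric_pair (m i) (v i) = 1" "\<And>k. k \<in> R \<Longrightarrow> toric_pair (m i) (v k) = 0"
    using m(1) R by (auto simp: dual_on_def)
  ultimately have "toric_pair (m' j) (v i) * a = 1"
    by simp
  then have "a = 1 \<or> a = -1"
    by (metis dvd_triv_right zdvd1_eq abs_eq_iff' abs_1)
  moreover have "a \<noteq> 1"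
    using cones_over_facet_separated[OF T, of i "\<lambda>k. toric_pair (m k) (v j)"] S R j vj by auto
  ultimately show ?thesis
    by (simp add: a_def)
qed

text \<open>For existence, step from the facet \<open>R\<close> in the direction
  \<open>- v i\<close>. For uniqueness, two candidates both have coordinate -1 at
  \<open>v i\<close>, so they differ by a combination of \<open>R\<close>, which
  \<open>cones_over_facet_separated\<close> excludes.\<close>

lemma wall_crossing:
  assumes S: "S \<in> F" "card S = CARD('d)" "i \<in> S"
  shows "\<exists>!j. j \<notin> S \<and> insert j (S - {i}) \<in> F"
proof -
  define R where "R = S - {i}"
  have R: "S = insert i R" "i \<notin> R" "finite R" "R \<in> F"
    unfolding R_def using insert_Diff[OF S(3)] finite_cone[OF S(1)] face_closed[OF S(1)] by simp_all
  obtain m where m: "dual_on v S m" "\<And>x. x = (\<Sum>k\<in>S. toric_pair (m k) x *s v k)"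
    using expansion[OF S(1,2)] by blast
  have mi: "toric_pair (m i) (v i) = 1" "\<And>k. k \<in> R \<Longrightarrow> toric_pair (m i) (v k) = 0"
    using m(1) R by (auto simp: dual_on_def)
  obtain T M where T: "T \<in> F" "R \<subseteq> T" "M *s (\<Sum>k\<in>R. v k) + (- v i) \<in> int_cone v T"
    using extend_cone[OF R(4)] .
  obtain c where c: "\<forall>k\<in>T. c k \<ge> 0" "M *s (\<Sum>k\<in>R. v k) + (- v i) = (\<Sum>k\<in>T. c k *s v k)"
    using T(3) unfolding int_cone_def by blast
  \<comment> \<open>A negative value across the wall rules out \<open>T = R\<close>, and also
    \<open>i \<in> T\<close>, which would give \<open>T = S\<close>, where this coordinate is
    nonnegative.\<close>
  have pair: "(\<Sum>k\<in>T. c k * toric_pair (m i) (v k)) = -1"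
    using arg_cong[OF c(2), of "toric_pair (m i)"] by (simp add: toric_pair_linear mi)
  have "T \<noteq> R"
    using pair mi by auto
  moreover have "i \<notin> T"
  proof
    assume "i \<in> T"
    then have "S \<subseteq> T"
      using T R by simp
    then have "S = T"
      using card_seteq[OF finite_cone[OF T(1)]] card_cone_le[OF T(1)] S(2) by simp
    then have "(\<Sum>k\<in>T. c k * toric_pair (m i) (v k)) \<ge> 0"
      using m(1) S(3) c(1) by (intro sum_nonneg) (auto simp: dual_on_def)
    then show False
      using pair by simp
  qed
  ultimately obtain j where j: "j \<in> T" "j \<notin> R" "j \<noteq> i"
    using T(2) by blast
  have ex: "j \<notin> S \<and> insert j R \<in> F"
    using j T R face_closed[OF T(1), of "insert j R"] by auto
  moreover have "j = j'" if j': "j' \<notin> S \<and> insert j' R \<in> F" for j'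
  proof (rule ccontr)
    assume ne: "j \<noteq> j'"
    have expand: "v l = - v i + (\<Sum>k\<in>R. toric_pair (m k) (v l) *s v k)"
      if "l \<notin> S \<and> insert l R \<in> F" for l
    proof -
      have "toric_pair (m i) (v l) = -1"
        using adjacent_coefficient[OF S(1,3) _ _ m(1) _ S(2), of l] that m(2) R_def by blast
      then show ?thesis
        using m(2)[of "v l"] R by (simp add: vector_smult_lneg)
    qed
    have "v j = v j' + (\<Sum>k\<in>R. (toric_pair (m k) (v j) - toric_pair (m k) (v j')) *s v k)"
    proof -
      have "x = y + (a - b)" if "x = - z + a" "y = - z + b" for x y z a b :: "int^'d"
        using that by simp
      from this[OF expand[OF ex] expand[OF j']] show ?thesis
        by (simp add: vector_sub_rdistrib sum_subtractf)
    qed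
    then show False
      using cones_over_facet_separated[OF conjunct2[OF ex] conjunct2[OF j'] ne] ex j' R(1)
      by (metis insertCI)
  qed
  ultimately show ?thesis
    unfolding R_def by blast
qed

end

section \<open>Intersection numbers on projective bundles\<close>

text \<open>Serves to choose \<open>I\<close> so that the differences \<open>a i - a k\<close> are
  nonpositive for \<open>k\<close> outside \<open>I\<close>.\<close>

lemma smallest_subset:
  fixes a :: "nat \<Rightarrow> 'a::linorder"
  assumes "finite P" "k \<le> card P"
  obtains I where "I \<subseteq> P" "card I = k" "\<And>i j. i \<in> I \<Longrightarrow> j \<in> P - I \<Longrightarrow> a i \<le> a j"
proof -
  have "\<exists>I\<subseteq>P. card I = k \<and> (\<forall>i\<in>I. \<forall>j\<in>P - I. a i \<le> a j)"
    using assms(2)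
  proof (induction k)
    case 0
    show ?case
      by (intro exI[of _ "{}"]) auto
  next
    case (Suc k)
    then obtain I where I: "I \<subseteq> P" "card I = k" "\<forall>i\<in>I. \<forall>j\<in>P - I. a i \<le> a j"
      by auto
    have "P - I \<noteq> {}"
      using I Suc.prems assms(1) by (metis Diff_eq_empty_iff card_mono finite_subset not_less_eq_eq)
    then have "Min (a ` (P - I)) \<in> a ` (P - I)"
      using assms(1) by (intro Min_in) auto
    then obtain x where x: "x \<in> P - I" "a x = Min (a ` (P - I))"
      by auto
    have "a x \<le> a j" if "j \<in> P - I" for j
      using that x(2) assms(1) by simp
    moreover have "card (insert x I) = Suc k"
      using I x assms(1) finite_subset by (metis DiffD2 card_insert_disjoint)
    ultimately show ?case
      using I x by (intro exI[of _ "insert x I"]) auto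
  qed
  then show thesis
    using that by blast
qed

text \<open>The intersection numbers of a projective bundle over a projective space: the divisors indexed by
  Q have a common class H, and those indexed by P have classes \<xi> - a i H.\<close>

locale bundle_intersection =
  fixes P Q :: "nat set" and N :: nat and deg :: "nat multiset \<Rightarrow> rat" and a :: "nat \<Rightarrow> rat"
    and q0 :: nat
  assumes finite_P: "finite P" and finite_Q: "finite Q" and disjoint: "P \<inter> Q = {}"
    and card_P: "2 \<le> card P" and card_Q: "2 \<le> card Q"
    and card_PQ: "card P + card Q = N + 2" and N_ge: "5 \<le> N"
    and q0: "q0 \<in> Q"
    and base_class: "\<And>i M. i \<in> Q \<Longrightarrow> size M = N - 1 \<Longrightarrow> set_mset M \<subseteq> P \<union> Q \<Longrightarrow>
      deg (add_mset i M) = deg (add_mset q0 M)"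
    and fibre_class: "\<And>i j M. i \<in> P \<Longrightarrow> j \<in> P \<Longrightarrow> size M = N - 1 \<Longrightarrow> set_mset M \<subseteq> P \<union> Q \<Longrightarrow>
      deg (add_mset i M) = deg (add_mset j M) + (a j - a i) * deg (add_mset q0 M)"
    and non_face: "\<And>M. size M = N \<Longrightarrow> set_mset M \<subseteq> P \<union> Q \<Longrightarrow> P \<subseteq> set_mset M \<or> Q \<subseteq> set_mset M \<Longrightarrow>
      deg M = 0"
    and maximal_cone: "\<And>p q. p \<in> P \<Longrightarrow> q \<in> Q \<Longrightarrow> deg (mset_set (P \<union> Q - {p, q})) = 1"
begin

text \<open>The polarised quartic intersection form on the fourfold \<open>V(\<tau>)\<close>. Four
  separate arguments allow divisors to be exchanged one at a time; the diagonal gives the terms of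
  \<open>ch_4\<close>.\<close>

definition quad :: "nat set \<Rightarrow> nat \<Rightarrow> nat \<Rightarrow> nat \<Rightarrow> nat \<Rightarrow> rat" where
  "quad \<tau> x y z w = deg ({#x, y, z, w#} + mset_set \<tau>)"

section \<open>Exchange rules on a fixed fourfold\<close>

context
  fixes \<tau> :: "nat set"
  assumes \<tau>: "\<tau> \<subseteq> P \<union> Q" "card \<tau> = N - 4"
begin

private lemma finite_\<tau>: "finite \<tau>"
  using \<tau> finite_P finite_Q finite_subset by blast

text \<open>Adjacent transpositions generate all permutations; as rewrite rules they sort the
  arguments.\<close>

lemma quad_swap:
  "quad \<tau> x y z w = quad \<tau> y x z w"
  "quad \<tau> x y z w = quad \<tau> x z y w"
  "quad \<tau> x y z w = quad \<tau> x y w z"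
  unfolding quad_def by (simp_all add: add_mset_commute)

lemma quad_fibre:
  assumes "i \<in> P" "j \<in> P" "{x, y, z} \<subseteq> P \<union> Q"
  shows "quad \<tau> i x y z = quad \<tau> j x y z + (a j - a i) * quad \<tau> q0 x y z"
  using fibre_class[of i j "{#x, y, z#} + mset_set \<tau>"] assms \<tau> finite_\<tau> N_ge
  by (simp add: quad_def)

lemma quad_base1: "i \<in> Q \<Longrightarrow> {x, y, z} \<subseteq> P \<union> Q \<Longrightarrow> quad \<tau> i x y z = quad \<tau> q0 x y z"
  using base_class[of i "{#x, y, z#} + mset_set \<tau>"] \<tau> finite_\<tau> N_ge
  by (simp add: quad_def)

text \<open>Symmetry brings each further index of \<open>Q\<close> to the front, where the previous
  rule replaces it by \<open>q0\<close>.\<close>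

lemma quad_base2:
  assumes "{i, j} \<subseteq> Q" "{x, y} \<subseteq> P \<union> Q"
  shows "quad \<tau> i j x y = quad \<tau> q0 q0 x y"
  using quad_base1[of i j x y] quad_base1[of j q0 x y] assms q0 by (simp add: quad_swap)

lemma quad_base3:
  assumes "{i, j, k} \<subseteq> Q" "x \<in> P \<union> Q"
  shows "quad \<tau> i j k x = quad \<tau> q0 q0 q0 x"
  using quad_base2[of i j k x] quad_base1[of k q0 q0 x] assms q0 by (simp add: quad_swap)

lemma quad_base4:
  assumes "{i, j, k, l} \<subseteq> Q"
  shows "quad \<tau> i j k l = quad \<tau> q0 q0 q0 q0"
  using quad_base3[of i j k l] quad_base1[of l q0 q0 q0] assms q0 by (simp add: quad_swap)
lemma quad_non_face:
  assumes "{x, y, z, w} \<subseteq> P \<union> Q" "P \<subseteq> {x, y, z, w} \<union> \<tau> \<or> Q \<subseteq> {x, y, z, w} \<union> \<tau>"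
  shows "quad \<tau> x y z w = 0"
  unfolding quad_def by (rule non_face) (use assms \<tau> finite_\<tau> N_ge in auto)

lemma quad_maximal_cone:
  assumes "p \<in> P" "q \<in> Q" "{x, y, z, w} \<union> \<tau> = P \<union> Q - {p, q}" "distinct [x, y, z, w]"
    "{x, y, z, w} \<inter> \<tau> = {}"
  shows "quad \<tau> x y z w = 1"
proof -
  have "{#x, y, z, w#} + mset_set \<tau> = mset_set (P \<union> Q - {p, q})"
    unfolding assms(3)[symmetric] using assms(4,5) finite_\<tau> by simp
  then show ?thesis
    using maximal_cone[OF assms(1,2)] by (simp add: quad_def)
qed

lemma sum_quad:
  "(\<Sum>k\<in>P \<union> Q. deg (replicate_mset 4 k + mset_set \<tau>))
    = (\<Sum>k\<in>P. quad \<tau> k k k k) + of_nat (card Q) * quad \<tau> q0 q0 q0 q0"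
proof -
  have "(\<Sum>k\<in>P \<union> Q. deg (replicate_mset 4 k + mset_set \<tau>)) = (\<Sum>k\<in>P \<union> Q. quad \<tau> k k k k)"
    by (simp add: quad_def numeral_eq_Suc)
  also have "\<dots> = (\<Sum>k\<in>P. quad \<tau> k k k k) + (\<Sum>k\<in>Q. quad \<tau> k k k k)"
    using finite_P finite_Q disjoint by (rule sum.union_disjoint)
  also have "(\<Sum>k\<in>Q. quad \<tau> k k k k) = (\<Sum>k\<in>Q. quad \<tau> q0 q0 q0 q0)"
    by (intro sum.cong refl quad_base4) auto
  finally show ?thesis
    by simp
qed

end

section \<open>Fourfolds on which \<open>ch_4\<close> is nonpositive\<close>

lemma card_four:
  assumes "card A = 4"
  obtains x y z w where "A = {x, y, z, w}" "distinct [x, y, z, w]"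
  using assms by (auto simp: card_Suc_eq numeral_eq_Suc)

text \<open>Geometrically \<open>V(\<tau>)\<close> is a bundle of projective lines over projective
  3-space. With \<open>I = {i, j}\<close> its intersection numbers follow from H^4 = 0, D_i D_j = 0
  and H^3 D_j = 1.\<close>

lemma nonpositive_over_base:
  assumes "4 \<le> card Q"
  obtains \<tau> where "\<tau> \<subseteq> P \<union> Q" "card \<tau> = N - 4" "\<not> P \<subseteq> \<tau>" "\<not> Q \<subseteq> \<tau>"
    "(\<Sum>k\<in>P \<union> Q. deg (replicate_mset 4 k + mset_set \<tau>)) \<le> 0"
proof -
  obtain I where I: "I \<subseteq> P" "card I = 2" "\<And>i j. i \<in> I \<Longrightarrow> j \<in> P - I \<Longrightarrow> a i \<le> a j"
    using smallest_subset[OF finite_P card_P] by metis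
  then obtain i j where ij: "I = {i, j}" "i \<noteq> j"
    by (auto simp: card_2_iff)
  obtain J where J: "J \<subseteq> Q" "card J = 4"
    using obtain_subset_with_card_n[OF assms] by metis
  then obtain x y z w where J_eq: "J = {x, y, z, w}" "distinct [x, y, z, w]"
    using card_four by metis
  define \<tau> where "\<tau> = P \<union> Q - (I \<union> J)"
  have fin: "finite I" "finite J"
    using I(1) J(1) finite_P finite_Q finite_subset by auto
  have "card \<tau> = card (P \<union> Q) - card (I \<union> J)"
    unfolding \<tau>_def using fin I(1) J(1) by (intro card_Diff_subset) auto
  also have "card (I \<union> J) = 6"
    using I J disjoint fin by (subst card_Un_disjoint) auto
  also have "card (P \<union> Q) = N + 2"
    using card_PQ finite_P finite_Q disjoint by (simp add: card_Un_disjoint)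
  finally have \<tau>: "\<tau> \<subseteq> P \<union> Q" "card \<tau> = N - 4"
    by (auto simp: \<tau>_def)
  define g where "g = quad \<tau>"
  note swap = quad_swap[OF \<tau>, folded g_def]
  note fibre = quad_fibre[OF \<tau>, folded g_def]
  note base3 = quad_base3[OF \<tau>, folded g_def]
  note base4 = quad_base4[OF \<tau>, folded g_def]
  note vanish = quad_non_face[OF \<tau>, folded g_def]
  note one = quad_maximal_cone[OF \<tau>, folded g_def]
  have mem: "i \<in> P" "j \<in> P" "x \<in> Q" "y \<in> Q" "z \<in> Q" "w \<in> Q"
    using I(1) J(1) ij J_eq by auto
  have not_Q: "i \<notin> Q" "j \<notin> Q" "x \<notin> P" "y \<notin> P" "z \<notin> P" "w \<notin> P"
    using mem disjoint by auto
  have covered: "P \<subseteq> {i, j} \<union> \<tau>" "Q \<subseteq> {x, y, z, w} \<union> \<tau>"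
    using not_Q disjoint by (auto simp: \<tau>_def ij J_eq)
  have "g x y z w = 0"
    using covered(2) mem by (intro vanish) auto
  then have HHHH: "g q0 q0 q0 q0 = 0"
    using base4[of x y z w] mem by simp
  \<comment> \<open>Together with \<open>\<tau>\<close>, the indices \<open>x\<close>,
    \<open>y\<close>, \<open>z\<close>, \<open>j\<close> form the maximal cone that omits
    \<open>i\<close> and \<open>w\<close>.\<close>
  have HHHj: "g q0 q0 q0 j = 1"
  proof -
    have "g q0 q0 q0 j = g x y z j"
      using base3[of x y z j] mem q0 by auto
    also have "\<dots> = 1"
      by (rule one[of i w]) (use mem not_Q J_eq ij in \<open>auto simp: \<tau>_def\<close>)
    finally show ?thesis .
  qed
  have ij0: "g i j k l = 0" if "{k, l} \<subseteq> P \<union> Q" for k l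
    using covered(1) that mem by (intro vanish) auto
  have quartic: "g k k k k = ((a i - a k) + (a j - a k)) * ((a i - a k)^2 + (a j - a k)^2)"
    if k: "k \<in> P" for k
  proof -
    \<comment> \<open>Two reductions drive the computation: D_j D_k = (a i - a k) H D_j, from D_i
      D_j = 0, and D_k = D_j + (a j - a k) H. They lower the power of D_k step by step.\<close>
    have j1: "g j k l m = (a i - a k) * g q0 j l m" if "{l, m} \<subseteq> P \<union> Q" for l m
      using fibre[of k i j l m] ij0[of l m] k mem that by (simp add: swap)
    have H: "g q0 k l m = g q0 j l m + (a j - a k) * g q0 q0 l m" if "{l, m} \<subseteq> P \<union> Q" for l m
      using fibre[of k j q0 l m] k mem that q0 by (simp add: swap)
    have HHHk: "g q0 q0 q0 k = 1"
      using H[of q0 q0] HHHj HHHH q0 by (simp add: swap)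
    have HHjk: "g q0 q0 j k = a i - a k"
      using j1[of q0 q0] HHHj q0 by (simp add: swap)
    have HHkk: "g q0 q0 k k = (a i - a k) + (a j - a k)"
      using H[of q0 k] HHjk HHHk k q0 by (simp add: swap)
    have Hjkk: "g q0 j k k = (a i - a k)^2"
      using j1[of q0 k] HHjk k q0 by (simp add: swap power2_eq_square)
    have jkkk: "g j k k k = (a i - a k)^3"
      using j1[of k k] Hjkk k by (auto simp: power2_eq_square power3_eq_cube)
    have Hkkk: "g q0 k k k = (a i - a k)^2 + (a j - a k) * ((a i - a k) + (a j - a k))"
      using H[of k k] Hjkk HHkk k by auto
    have "g k k k k = g j k k k + (a j - a k) * g q0 k k k"
      using fibre[of k j k k k] k mem by auto
    then show ?thesis
      unfolding jkkk Hkkk by (simp add: algebra_simps power2_eq_square power3_eq_cube)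
  qed
  have "(\<Sum>k\<in>P - I. g k k k k) \<le> 0"
  proof (rule sum_nonpos)
    fix k assume k: "k \<in> P - I"
    then have "a i - a k \<le> 0" "a j - a k \<le> 0"
      using I(3) ij by auto
    then show "g k k k k \<le> 0"
      using quartic k by (auto intro!: mult_nonpos_nonneg)
  qed
  \<comment> \<open>The two terms are the cubes of \<open>a j - a i\<close> and
    \<open>a i - a j\<close>.\<close>
  moreover have "(\<Sum>k\<in>I. g k k k k) = 0"
    using ij quartic[OF mem(1)] quartic[OF mem(2)] by (simp add: power2_eq_square algebra_simps)
  moreover have "(\<Sum>k\<in>P. g k k k k) = (\<Sum>k\<in>P - I. g k k k k) + (\<Sum>k\<in>I. g k k k k)"
    using I(1) finite_P by (rule sum.subset_diff)
  ultimately have "(\<Sum>k\<in>P \<union> Q. deg (replicate_mset 4 k + mset_set \<tau>)) \<le> 0"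
    using sum_quad[OF \<tau>, folded g_def] HHHH by simp
  moreover have "\<not> P \<subseteq> \<tau>" "\<not> Q \<subseteq> \<tau>"
    using mem by (auto simp: \<tau>_def ij J_eq)
  ultimately show thesis
    using that \<tau> by blast
qed

text \<open>Geometrically \<open>V(\<tau>)\<close> is a bundle of projective 3-spaces over a line.
  Here H^2 = 0, the product of the four divisors of \<open>I\<close> vanishes, and H times any three
  divisors from \<open>P\<close> is 1.\<close>

lemma nonpositive_over_line:
  assumes "4 \<le> card P"
  obtains \<tau> where "\<tau> \<subseteq> P \<union> Q" "card \<tau> = N - 4" "\<not> P \<subseteq> \<tau>" "\<not> Q \<subseteq> \<tau>"
    "(\<Sum>k\<in>P \<union> Q. deg (replicate_mset 4 k + mset_set \<tau>)) \<le> 0"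
proof -
  obtain I where I: "I \<subseteq> P" "card I = 4" "\<And>i j. i \<in> I \<Longrightarrow> j \<in> P - I \<Longrightarrow> a i \<le> a j"
    using smallest_subset[OF finite_P assms] by metis
  then obtain i\<^sub>1 i\<^sub>2 i\<^sub>3 i\<^sub>4 where I_eq: "I = {i\<^sub>1, i\<^sub>2, i\<^sub>3, i\<^sub>4}" "distinct [i\<^sub>1, i\<^sub>2, i\<^sub>3, i\<^sub>4]"
    using card_four by metis
  obtain J where J: "J \<subseteq> Q" "card J = 2"
    using obtain_subset_with_card_n[OF card_Q] by metis
  then obtain x y where J_eq: "J = {x, y}" "x \<noteq> y"
    by (auto simp: card_2_iff)
  define \<tau> where "\<tau> = P \<union> Q - (I \<union> J)"
  have fin: "finite I" "finite J"
    using I(1) J(1) finite_P finite_Q finite_subset by auto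
  have "card \<tau> = card (P \<union> Q) - card (I \<union> J)"
    unfolding \<tau>_def using fin I(1) J(1) by (intro card_Diff_subset) auto
  also have "card (I \<union> J) = 6"
    using I J disjoint fin by (subst card_Un_disjoint) auto
  also have "card (P \<union> Q) = N + 2"
    using card_PQ finite_P finite_Q disjoint by (simp add: card_Un_disjoint)
  finally have \<tau>: "\<tau> \<subseteq> P \<union> Q" "card \<tau> = N - 4"
    by (auto simp: \<tau>_def)
  define g where "g = quad \<tau>"
  note swap = quad_swap[OF \<tau>, folded g_def]
  note fibre = quad_fibre[OF \<tau>, folded g_def]
  note base1 = quad_base1[OF \<tau>, folded g_def]
  note base2 = quad_base2[OF \<tau>, folded g_def]
  note vanish = quad_non_face[OF \<tau>, folded g_def]
  note one = quad_maximal_cone[OF \<tau>, folded g_def]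
  have mem: "i\<^sub>1 \<in> P" "i\<^sub>2 \<in> P" "i\<^sub>3 \<in> P" "i\<^sub>4 \<in> P" "x \<in> Q" "y \<in> Q"
    using I(1) J(1) I_eq J_eq by auto
  have not_Q: "i\<^sub>1 \<notin> Q" "i\<^sub>2 \<notin> Q" "i\<^sub>3 \<notin> Q" "i\<^sub>4 \<notin> Q" "x \<notin> P" "y \<notin> P"
    using mem disjoint by auto
  have covered: "P \<subseteq> I \<union> \<tau>" "Q \<subseteq> {x, y} \<union> \<tau>"
    using I(1) disjoint not_Q by (auto simp: \<tau>_def J_eq)
  have HH: "g q0 q0 k l = 0" if "{k, l} \<subseteq> P \<union> Q" for k l
  proof -
    have "g x y k l = 0"
      using covered(2) that mem by (intro vanish) auto
    then show ?thesis
      using base2[of x y k l] mem that by simp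
  qed
  \<comment> \<open>Since H^2 = 0, the twists disappear after multiplication by H, so all divisors
    from \<open>P\<close> become interchangeable.\<close>
  have H: "g q0 k l m = g q0 k' l m" if "{k, k', l, m} \<subseteq> P" for k k' l m
    using fibre[of k k' q0 l m] HH[of l m] that q0 by (simp add: swap)
  have "g q0 i\<^sub>1 i\<^sub>2 i\<^sub>3 = g x i\<^sub>1 i\<^sub>2 i\<^sub>3"
    using base1[of x i\<^sub>1 i\<^sub>2 i\<^sub>3] mem q0 by auto
  also have "\<dots> = 1"
    by (rule one[of i\<^sub>4 y]) (use mem not_Q J_eq I_eq in \<open>auto simp: \<tau>_def\<close>)
  finally have H123: "g q0 i\<^sub>1 i\<^sub>2 i\<^sub>3 = 1" .
  have Hklm: "g q0 k l m = 1" if "{k, l, m} \<subseteq> P" for k l m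
  proof -
    have "g q0 k l m = g q0 i\<^sub>1 l m"
      using that mem by (intro H) auto
    also have "\<dots> = g q0 l i\<^sub>1 m"
      by (rule swap(2))
    also have "\<dots> = g q0 i\<^sub>2 i\<^sub>1 m"
      using that mem by (intro H) auto
    also have "\<dots> = g q0 m i\<^sub>2 i\<^sub>1"
      by (simp add: swap)
    also have "\<dots> = g q0 i\<^sub>3 i\<^sub>2 i\<^sub>1"
      using that mem by (intro H) auto
    also have "\<dots> = 1"
      using H123 by (simp add: swap)
    finally show ?thesis .
  qed
  have step: "g k l m m' = g i l m m' + (a i - a k)" if "{i, k, l, m, m'} \<subseteq> P" for i k l m m'
    using fibre[of k i l m m'] Hklm[of l m m'] that by auto
  \<comment> \<open>The four factors D_k are replaced in turn by the divisors of \<open>I\<close>;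
    each exchange costs one difference \<open>a i - a k\<close>, and the final product is 0.\<close>
  have quartic: "g k k k k = (\<Sum>i\<in>I. a i - a k)" if k: "k \<in> P" for k
  proof -
    have "g k k k k = g i\<^sub>1 k k k + (a i\<^sub>1 - a k)"
      using k mem by (intro step) auto
    also have "g i\<^sub>1 k k k = g k i\<^sub>1 k k"
      by (rule swap(1))
    also have "\<dots> = g i\<^sub>2 i\<^sub>1 k k + (a i\<^sub>2 - a k)"
      using k mem by (intro step) auto
    also have "g i\<^sub>2 i\<^sub>1 k k = g k i\<^sub>2 i\<^sub>1 k"
      by (simp add: swap)
    also have "\<dots> = g i\<^sub>3 i\<^sub>2 i\<^sub>1 k + (a i\<^sub>3 - a k)"
      using k mem by (intro step) auto
    also have "g i\<^sub>3 i\<^sub>2 i\<^sub>1 k = g k i\<^sub>3 i\<^sub>2 i\<^sub>1"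
      by (simp add: swap)
    also have "\<dots> = g i\<^sub>4 i\<^sub>3 i\<^sub>2 i\<^sub>1 + (a i\<^sub>4 - a k)"
      using k mem by (intro step) auto
    also have "g i\<^sub>4 i\<^sub>3 i\<^sub>2 i\<^sub>1 = 0"
      using covered(1) mem by (intro vanish) (auto simp: I_eq)
    finally show ?thesis
      using I_eq by simp
  qed
  have "(\<Sum>k\<in>P - I. g k k k k) \<le> 0"
  proof (rule sum_nonpos)
    fix k assume k: "k \<in> P - I"
    then show "g k k k k \<le> 0"
      using quartic I(3) by (auto intro!: sum_nonpos)
  qed
  \<comment> \<open>The double sum of \<open>a i - a k\<close> over \<open>I\<close> is
    antisymmetric.\<close>
  moreover have "(\<Sum>k\<in>I. g k k k k) = 0"
    using I_eq quartic mem by simp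
  moreover have "(\<Sum>k\<in>P. g k k k k) = (\<Sum>k\<in>P - I. g k k k k) + (\<Sum>k\<in>I. g k k k k)"
    using I(1) finite_P by (rule sum.subset_diff)
  moreover have "g q0 q0 q0 q0 = 0"
    using HH q0 by auto
  ultimately have "(\<Sum>k\<in>P \<union> Q. deg (replicate_mset 4 k + mset_set \<tau>)) \<le> 0"
    using sum_quad[OF \<tau>, folded g_def] by simp
  moreover have "\<not> P \<subseteq> \<tau>" "\<not> Q \<subseteq> \<tau>"
    using mem by (auto simp: \<tau>_def I_eq J_eq)
  ultimately show thesis
    using that \<tau> by blast
qed

text \<open>The two parts have at least 7 elements together, so one of them has at least 4.\<close>

lemma ch4_nonpositive:
  obtains \<tau> where "\<tau> \<subseteq> P \<union> Q" "card \<tau> = N - 4" "\<not> P \<subseteq> \<tau>" "\<not> Q \<subseteq> \<tau>"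
    "(\<Sum>k\<in>P \<union> Q. deg (replicate_mset 4 k + mset_set \<tau>)) \<le> 0"
proof (cases "4 \<le> card Q")
  case True
  then show thesis
    using nonpositive_over_base that by blast
next
  case False
  then have "4 \<le> card P"
    using card_PQ N_ge by linarith
  then show thesis
    using nonpositive_over_line that by blast
qed

end

section \<open>Fans with two more rays than the dimension\<close>

text \<open>Every vertex off an edge is joined to exactly one of its ends. Sorting the vertices by
  the ends of one fixed edge gives the two parts.\<close>

lemma bipartition_of_edge_exchange:
  assumes sym: "\<And>x y. E x y \<Longrightarrow> E y x" and irrefl: "\<And>x. \<not> E x x"
    and V: "\<And>x y. E x y \<Longrightarrow> x \<in> V"
    and exchange: "\<And>p q i. E p q \<Longrightarrow> i \<in> V \<Longrightarrow> i \<noteq> p \<Longrightarrow> i \<noteq> q \<Longrightarrow> E i p \<noteq> E i q"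
    and edge: "E p0 q0"
  obtains P Q where "P \<union> Q = V" "P \<inter> Q = {}" "P \<noteq> {}" "Q \<noteq> {}"
    "\<And>x y. E x y \<longleftrightarrow> x \<in> P \<and> y \<in> Q \<or> x \<in> Q \<and> y \<in> P"
proof
  define P where "P = {x. E x q0}"
  define Q where "Q = {x. E x p0}"
  have edge': "E q0 p0"
    using edge sym by blast
  show union: "P \<union> Q = V"
    using exchange[OF edge] V edge edge' unfolding P_def Q_def by blast
  show disj: "P \<inter> Q = {}"
    using exchange[OF edge] V irrefl unfolding P_def Q_def by blast
  show "P \<noteq> {}" "Q \<noteq> {}"
    using edge edge' by (auto simp: P_def Q_def)
  have cross: "E x y" if "x \<in> P" "y \<in> Q" for x y
  proof (cases "x = p0")
    case True
    then show ?thesis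
      using that sym by (auto simp: Q_def)
  next
    case False
    have "E p0 y"
      using that sym by (auto simp: Q_def)
    moreover have "x \<noteq> y" "\<not> E x p0" "x \<in> V"
      using that disj union by (auto simp: Q_def)
    ultimately show ?thesis
      using exchange False by blast
  qed
  \<comment> \<open>An edge inside a part would form a triangle with \<open>q0\<close> or
    \<open>p0\<close>.\<close>
  have "\<not> E x y" if "{x, y} \<subseteq> P \<or> {x, y} \<subseteq> Q" for x y
  proof
    assume "E x y"
    moreover have "y \<in> V" "x \<in> V"
      using that union by auto
    ultimately show False
      using exchange[of x q0 y] exchange[of x p0 y] that sym irrefl unfolding P_def Q_def by blast
  qed
  then show "E x y \<longleftrightarrow> x \<in> P \<and> y \<in> Q \<or> x \<in> Q \<and> y \<in> P" for x y
    using cross sym V union by blast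
qed

text \<open>The Picard number is \<open>n\<close> minus the dimension, so this is the case of Picard
  number 2.\<close>

locale rank_two_fan = toric_fan n v F for n :: nat and v :: "nat \<Rightarrow> int^'d" and F +
  assumes n_eq: "n = CARD('d) + 2"
begin

text \<open>A maximal cone omits exactly two rays, so maximal cones become the edges of a graph on
  the rays.\<close>

definition opposite :: "nat \<Rightarrow> nat \<Rightarrow> bool" where
  "opposite p q \<longleftrightarrow> p < n \<and> q < n \<and> p \<noteq> q \<and> {..<n} - {p, q} \<in> F"

lemma opposite_sym: "opposite p q \<Longrightarrow> opposite q p"
  by (auto simp: opposite_def insert_commute)

lemma card_opposite: "opposite p q \<Longrightarrow> card ({..<n} - {p, q}) = CARD('d)"
  unfolding opposite_def by (simp add: n_eq card_Diff_subset)

lemma maximal_cone_opposite: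
  assumes "T \<in> F" "card T = CARD('d)"
  obtains p q where "opposite p q" "T = {..<n} - {p, q}"
proof -
  have "card ({..<n} - T) = 2"
    using assms cone_subset[OF assms(1)] finite_cone[OF assms(1)] by (simp add: card_Diff_subset n_eq)
  then obtain p q where pq: "{..<n} - T = {p, q}" "p \<noteq> q"
    by (auto simp: card_2_iff)
  then have T: "T = {..<n} - {p, q}" "{p, q} \<subseteq> {..<n}"
    using cone_subset[OF assms(1)] by blast+
  then have "opposite p q"
    using pq(2) assms(1) by (auto simp: opposite_def)
  with T show thesis
    using that by blast
qed

text \<open>Crossing the wall opposite \<open>i\<close> must bring in \<open>p\<close> or
  \<open>q\<close>, and \<open>wall_crossing\<close> says that exactly one of them works.\<close>

lemma opposite_exchange:
  assumes pq: "opposite p q" and i: "i < n" "i \<noteq> p" "i \<noteq> q"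
  shows "opposite i p \<noteq> opposite i q"
proof -
  define S where "S = {..<n} - {p, q}"
  have S: "S \<in> F" "card S = CARD('d)" "i \<in> S"
    using pq i card_opposite[OF pq] by (auto simp: S_def opposite_def)
  have p: "insert p (S - {i}) = {..<n} - {i, q}" and q: "insert q (S - {i}) = {..<n} - {i, p}"
    using pq i by (auto simp: S_def opposite_def)
  have "opposite i q \<longleftrightarrow> insert p (S - {i}) \<in> F" "opposite i p \<longleftrightarrow> insert q (S - {i}) \<in> F"
    unfolding p q using pq i by (auto simp: opposite_def)
  moreover have "j = p \<or> j = q" if "j \<notin> S" "insert j (S - {i}) \<in> F" for j
    using cone_subset[OF that(2)] that(1) by (auto simp: S_def)
  moreover have "p \<notin> S" "q \<notin> S" "p \<noteq> q"
    using pq by (auto simp: S_def opposite_def)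
  ultimately show ?thesis
    using wall_crossing[OF S] by metis
qed

text \<open>\<open>P\<close> and \<open>Q\<close> are the two primitive collections of the fan: a
  set of rays spans a cone exactly when it contains neither.\<close>

definition splitting :: "nat set \<Rightarrow> nat set \<Rightarrow> bool" where
  "splitting P Q \<longleftrightarrow> P \<union> Q = {..<n} \<and> P \<inter> Q = {} \<and> P \<noteq> {} \<and> Q \<noteq> {} \<and>
     (\<forall>x y. opposite x y \<longleftrightarrow> x \<in> P \<and> y \<in> Q \<or> x \<in> Q \<and> y \<in> P)"

lemma splitting_sym: "splitting P Q \<Longrightarrow> splitting Q P"
  unfolding splitting_def by (metis Int_commute Un_commute)

lemma ex_splitting:
  obtains P Q where "splitting P Q"
proof -
  assume *: "\<And>P Q. splitting P Q \<Longrightarrow> thesis"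
  have "{0} \<in> F"
    by (rule ray_cone) (simp add: n_eq)
  then obtain T where T: "T \<in> F" "card T = CARD('d)"
    using extend_to_maximal by metis
  then obtain p0 q0 where edge: "opposite p0 q0"
    using maximal_cone_opposite by metis
  show thesis
  proof (rule bipartition_of_edge_exchange[of opposite "{..<n}" p0 q0])
    show "opposite i p \<noteq> opposite i q" if "opposite p q" "i \<in> {..<n}" "i \<noteq> p" "i \<noteq> q" for p q i
      using opposite_exchange[OF that(1)] that by simp
    show thesis if "P \<union> Q = {..<n}" "P \<inter> Q = {}" "P \<noteq> {}" "Q \<noteq> {}"
      "\<And>x y. opposite x y \<longleftrightarrow> x \<in> P \<and> y \<in> Q \<or> x \<in> Q \<and> y \<in> P" for P Q
      by (rule *[of P Q]) (simp add: splitting_def that)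
  qed (use opposite_sym edge in \<open>auto simp: opposite_def\<close>)
qed

lemma splitting_opposite: "splitting P Q \<Longrightarrow> p \<in> P \<Longrightarrow> q \<in> Q \<Longrightarrow> opposite p q"
  unfolding splitting_def by blast

text \<open>Every maximal cone omits one ray from each part.\<close>

lemma splitting_non_face:
  assumes "splitting P Q" "T \<in> F"
  shows "\<not> P \<subseteq> T"
proof
  assume PT: "P \<subseteq> T"
  obtain T' where T': "T' \<in> F" "T \<subseteq> T'" "card T' = CARD('d)"
    using extend_to_maximal[OF assms(2)] .
  then obtain p q where pq: "opposite p q" "T' = {..<n} - {p, q}"
    using maximal_cone_opposite by metis
  then have "p \<in> P \<or> q \<in> P"
    using assms(1) unfolding splitting_def by blast
  then show False
    using pq(2) PT T'(2) by blast
qed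

lemma splitting_card_ge_2:
  assumes "splitting P Q"
  shows "2 \<le> card P"
proof (rule ccontr)
  assume "\<not> 2 \<le> card P"
  moreover have P: "finite P" "P \<noteq> {}" "P \<subseteq> {..<n}"
    using assms by (auto simp: splitting_def intro: finite_subset[of P "{..<n}"])
  then have "card P \<noteq> 0"
    by simp
  ultimately have "card P = 1"
    by linarith
  then obtain p where "P = {p}"
    by (auto simp: card_1_singleton_iff)
  then show False
    using splitting_non_face[OF assms ray_cone[of p]] P(3) by auto
qed

text \<open>The basis complementary to \<open>{p, q}\<close>. The coordinates of \<open>v p\<close>
  and \<open>v q\<close> in it encode the primitive relations, with the twists as
  coefficients.\<close>

definition dual_frame :: "nat \<Rightarrow> nat \<Rightarrow> (nat \<Rightarrow> int^'d) \<Rightarrow> bool" where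
  "dual_frame p q m \<longleftrightarrow> dual_on v ({..<n} - {p, q}) m \<and>
     (\<forall>x. x = (\<Sum>i\<in>{..<n} - {p, q}. toric_pair (m i) x *s v i))"

lemma dual_frame_sym: "dual_frame p q m \<Longrightarrow> dual_frame q p m"
  by (simp add: dual_frame_def insert_commute)

lemma ex_dual_frame:
  assumes "opposite p q"
  obtains m where "dual_frame p q m"
proof -
  have "{..<n} - {p, q} \<in> F"
    using assms by (simp add: opposite_def)
  then obtain m where "dual_on v ({..<n} - {p, q}) m" "\<And>x. x = (\<Sum>i\<in>{..<n} - {p, q}. toric_pair (m i) x *s v i)"
    using expansion card_opposite[OF assms] by metis
  then show thesis
    using that unfolding dual_frame_def by blast
qed

text \<open>The cones omitting \<open>{p, q}\<close> and \<open>{i, q}\<close> are adjacent, so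
  \<open>adjacent_coefficient\<close> applies.\<close>

lemma dual_frame_fibre:
  assumes "splitting P Q" "p \<in> P" "q \<in> Q" "dual_frame p q m" "i \<in> P - {p}"
  shows "toric_pair (m i) (v p) = -1"
proof (rule adjacent_coefficient)
  have pq: "opposite p q" "opposite i q"
    using assms splitting_opposite by blast+
  then show "{..<n} - {p, q} \<in> F" "card ({..<n} - {p, q}) = CARD('d)"
    using card_opposite by (auto simp: opposite_def)
  show "i \<in> {..<n} - {p, q}"
    using pq assms(5) by (auto simp: opposite_def)
  have "insert p ({..<n} - {p, q} - {i}) = {..<n} - {i, q}"
    using pq assms(5) by (auto simp: opposite_def)
  then show "insert p ({..<n} - {p, q} - {i}) \<in> F"
    using pq by (simp add: opposite_def)
  show "dual_on v ({..<n} - {p, q}) m"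
    "v p = (\<Sum>k\<in>{..<n} - {p, q}. toric_pair (m k) (v p) *s v k)"
    using assms(4) unfolding dual_frame_def by blast+
qed simp

lemma dual_frame_base:
  assumes "splitting P Q" "p \<in> P" "q \<in> Q" "dual_frame p q m" "i \<in> Q - {q}"
  shows "toric_pair (m i) (v q) = -1"
  using dual_frame_fibre[OF splitting_sym[OF assms(1)] assms(3,2) dual_frame_sym[OF assms(4)] assms(5)] .

text \<open>Comparing the expansions of v p in the bases complementary to {p, q} and {p, i} shows that
  the two twisting vectors cannot both be nonzero, so one of the two primitive relations is untwisted.\<close>

lemma one_twist_vanishes:
  assumes split: "splitting P Q" "p \<in> P" "q \<in> Q" and m: "dual_frame p q m"
    and i: "i \<in> Q - {q}" "toric_pair (m i) (v p) \<noteq> 0" and j: "j \<in> P - {p}"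
  shows "toric_pair (m j) (v q) = 0"
proof -
  define S where "S = {..<n} - {p, q}"
  have PQ: "P \<union> Q = {..<n}" "P \<inter> Q = {}"
    using split(1) by (auto simp: splitting_def)
  have mem: "i \<in> S" "j \<in> S" "q < n" "i \<noteq> j" "q \<noteq> p" "i \<noteq> q"
    using PQ split(2,3) i(1) j by (auto simp: S_def)
  obtain m' where m': "dual_frame p i m'"
    using ex_dual_frame splitting_opposite[OF split(1,2)] i(1) by blast
  define c where "c k = toric_pair (m' k) (v p)" for k
  have "{..<n} - {p, i} = insert q (S - {i})"
    using mem by (auto simp: S_def)
  then have "v p = (\<Sum>k\<in>insert q (S - {i}). c k *s v k)"
    using m' unfolding dual_frame_def c_def by metis
  then have vp: "v p = c q *s v q + (\<Sum>k\<in>S - {i}. c k *s v k)"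
    by (simp add: S_def)
  have dual: "toric_pair (m x) (v k) = (if x = k then 1 else 0)" if "x \<in> S" "k \<in> S" for x k
    using m that unfolding dual_frame_def dual_on_def S_def by blast
  have "toric_pair (m i) (v p) = c q * toric_pair (m i) (v q)
      + (\<Sum>k\<in>S - {i}. c k * toric_pair (m i) (v k))"
    by (subst vp) (simp add: toric_pair_linear)
  also have "(\<Sum>k\<in>S - {i}. c k * toric_pair (m i) (v k)) = 0"
    using dual mem by (intro sum.neutral) auto
  also have "toric_pair (m i) (v q) = -1"
    using dual_frame_base[OF split m i(1)] .
  finally have "c q \<noteq> 0"
    using i(2) by simp
  \<comment> \<open>Both frames give \<open>v p\<close> the coordinate -1 at \<open>v j\<close>, so
    only \<open>c q\<close> times the wanted twist survives, and it must be 0.\<close>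
  have "toric_pair (m j) (v p) = c q * toric_pair (m j) (v q)
      + (\<Sum>k\<in>S - {i}. c k * toric_pair (m j) (v k))"
    by (subst vp) (simp add: toric_pair_linear)
  also have "(\<Sum>k\<in>S - {i}. c k * toric_pair (m j) (v k)) = (\<Sum>k\<in>S - {i}. if j = k then c k else 0)"
    using dual mem by (intro sum.cong) auto
  also have "\<dots> = c j"
    using mem by (simp add: S_def)
  also have "c j = -1"
    using dual_frame_fibre[OF split(1,2) _ m' j] i(1) by (simp add: c_def)
  also have "toric_pair (m j) (v p) = -1"
    using dual_frame_fibre[OF split m j] .
  finally show ?thesis
    using \<open>c q \<noteq> 0\<close> by simp
qed

text \<open>The linear relation given by \<open>m i\<close> involves only the divisors of
  \<open>i\<close>, \<open>p\<close> and \<open>q\<close>.\<close>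

lemma dual_frame_sum:
  fixes f :: "nat \<Rightarrow> rat"
  assumes "opposite p q" "dual_frame p q m" "i \<in> {..<n} - {p, q}"
  shows "(\<Sum>j<n. of_int (toric_pair (m i) (v j)) * f j)
    = f i + of_int (toric_pair (m i) (v p)) * f p + of_int (toric_pair (m i) (v q)) * f q"
proof -
  have "{..<n} = insert p (insert q ({..<n} - {p, q}))" "p \<noteq> q"
    using assms(1) by (auto simp: opposite_def)
  then have "(\<Sum>j<n. of_int (toric_pair (m i) (v j)) * f j)
      = of_int (toric_pair (m i) (v p)) * f p + (of_int (toric_pair (m i) (v q)) * f q
        + (\<Sum>j\<in>{..<n} - {p, q}. of_int (toric_pair (m i) (v j)) * f j))"
    by (metis (no_types, lifting) Diff_iff finite_Diff finite_insert finite_lessThan insertCI insertE sum.insert)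
  also have "(\<Sum>j\<in>{..<n} - {p, q}. of_int (toric_pair (m i) (v j)) * f j)
      = (\<Sum>j\<in>{..<n} - {p, q}. if i = j then f j else 0)"
    using assms(2,3) by (intro sum.cong) (auto simp: dual_frame_def dual_on_def)
  also have "\<dots> = f i"
    using assms(3) by simp
  finally show ?thesis
    by simp
qed

text \<open>Without twists on \<open>Q\<close> the linear relations become D_i = D_q for
  \<open>i \<in> Q\<close> and D_i = D_p - a i D_q for \<open>i \<in> P\<close>, which are those of
  \<open>bundle_intersection\<close>.\<close>

lemma untwisted_not_ch4_positive:
  assumes split: "splitting P Q" "p \<in> P" "q \<in> Q" and m: "dual_frame p q m"
    and untwisted: "\<And>i. i \<in> Q - {q} \<Longrightarrow> toric_pair (m i) (v p) = 0"
    and deg: "toric_degree n v F deg" and dim: "5 \<le> CARD('d)"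
  shows "\<not> ch_positive n v F deg 4"
proof -
  have PQ: "P \<union> Q = {..<n}" "P \<inter> Q = {}"
    using split(1) by (auto simp: splitting_def)
  have fin: "finite P" "finite Q"
    using PQ(1) by (metis finite_Un finite_lessThan)+
  have op: "opposite p q"
    using splitting_opposite[OF split] .
  have vanish: "\<And>M. size M = CARD('d) \<Longrightarrow> set_mset M \<subseteq> {..<n} \<Longrightarrow> set_mset M \<notin> F \<Longrightarrow> deg M = 0"
    and unit: "\<And>S. S \<in> F \<Longrightarrow> card S = CARD('d) \<Longrightarrow> deg (mset_set S) = 1"
    and linear: "\<And>m M. size M = CARD('d) - 1 \<Longrightarrow> set_mset M \<subseteq> {..<n} \<Longrightarrow>
      (\<Sum>j<n. of_int (toric_pair m (v j)) * deg (add_mset j M)) = 0"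
    using deg unfolding toric_degree_def by blast+
  \<comment> \<open>The class \<xi> is taken to be D_p, whence the value 0 at \<open>p\<close>,
    which lies outside the frame.\<close>
  define a :: "nat \<Rightarrow> rat" where "a i = (if i = p then 0 else of_int (toric_pair (m i) (v q)))" for i
  have base: "deg (add_mset i M) = deg (add_mset q M)"
    if i: "i \<in> Q" and M: "size M = CARD('d) - 1" "set_mset M \<subseteq> P \<union> Q" for i M
  proof (cases "i = q")
    case False
    then have "i \<in> {..<n} - {p, q}"
      using i PQ split by auto
    from dual_frame_sum[OF op m this, of "\<lambda>j. deg (add_mset j M)"] linear[OF M(1), of "m i"] show ?thesis
      using untwisted[of i] dual_frame_base[OF split m, of i] i False M(2) PQ(1) by simp
  qed simp
  have fibre: "deg (add_mset i M) = deg (add_mset p M) - a i * deg (add_mset q M)"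
    if i: "i \<in> P" and M: "size M = CARD('d) - 1" "set_mset M \<subseteq> P \<union> Q" for i M
  proof (cases "i = p")
    case False
    then have "i \<in> {..<n} - {p, q}"
      using i PQ split by auto
    from dual_frame_sum[OF op m this, of "\<lambda>j. deg (add_mset j M)"] linear[OF M(1), of "m i"] show ?thesis
      using dual_frame_fibre[OF split m, of i] i False M(2) PQ(1) by (simp add: a_def)
  qed (simp add: a_def)
  interpret bundle_intersection P Q "CARD('d)" deg a q
  proof
    show "finite P" "finite Q" "P \<inter> Q = {}" "q \<in> Q" "5 \<le> CARD('d)"
      using fin PQ split dim by auto
    show "2 \<le> card P" "2 \<le> card Q"
      using splitting_card_ge_2 split(1) splitting_sym by blast+
    show "card P + card Q = CARD('d) + 2"
      using card_Un_disjoint[OF fin PQ(2)] PQ(1) n_eq by simp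
    show "deg (add_mset i M) = deg (add_mset q M)"
      if "i \<in> Q" "size M = CARD('d) - 1" "set_mset M \<subseteq> P \<union> Q" for i M
      using base that .
    show "deg (add_mset i M) = deg (add_mset j M) + (a j - a i) * deg (add_mset q M)"
      if "i \<in> P" "j \<in> P" "size M = CARD('d) - 1" "set_mset M \<subseteq> P \<union> Q" for i j M
      using fibre[of i M] fibre[of j M] that by (simp add: algebra_simps)
    show "deg M = 0" if "size M = CARD('d)" "set_mset M \<subseteq> P \<union> Q"
      "P \<subseteq> set_mset M \<or> Q \<subseteq> set_mset M" for M
      using vanish that splitting_non_face[OF split(1)] splitting_non_face[OF splitting_sym[OF split(1)]]
      unfolding PQ(1) by blast
    show "deg (mset_set (P \<union> Q - {p', q'})) = 1" if "p' \<in> P" "q' \<in> Q" for p' q'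
      unfolding PQ(1) using splitting_opposite[OF split(1) that] card_opposite unit
      by (simp add: opposite_def)
  qed
  obtain \<tau> where \<tau>: "\<tau> \<subseteq> P \<union> Q" "card \<tau> = CARD('d) - 4" "\<not> P \<subseteq> \<tau>" "\<not> Q \<subseteq> \<tau>"
    "(\<Sum>k\<in>P \<union> Q. deg (replicate_mset 4 k + mset_set \<tau>)) \<le> 0"
    using ch4_nonpositive .
  \<comment> \<open>Since \<open>\<tau>\<close> misses a ray of each part, it is a face of a maximal
    cone.\<close>
  obtain p' q' where p'q': "p' \<in> P - \<tau>" "q' \<in> Q - \<tau>"
    using \<tau>(3,4) by blast
  then have "{..<n} - {p', q'} \<in> F"
    using splitting_opposite[OF split(1), of p' q'] by (auto simp: opposite_def)
  moreover have "\<tau> \<subseteq> {..<n} - {p', q'}"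
    using \<tau>(1) p'q' PQ by blast
  ultimately have "\<tau> \<in> F"
    by (rule face_closed)
  then show ?thesis
    using \<tau>(2,5) unfolding ch_positive_def PQ(1) by (auto simp: not_less intro!: bexI[of _ \<tau>] divide_nonpos_pos)
qed

lemma not_ch4_positive:
  assumes "toric_degree n v F deg" "5 \<le> CARD('d)"
  shows "\<not> ch_positive n v F deg 4"
proof -
  obtain P Q where split: "splitting P Q"
    using ex_splitting .
  then obtain p q where pq: "p \<in> P" "q \<in> Q"
    unfolding splitting_def by blast
  obtain m where m: "dual_frame p q m"
    using ex_dual_frame splitting_opposite[OF split pq] by blast
  show ?thesis
  proof (cases "\<forall>i\<in>Q - {q}. toric_pair (m i) (v p) = 0")
    case True
    then show ?thesis
      using untwisted_not_ch4_positive[OF split pq m] assms by blast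
  next
    case False
    \<comment> \<open>A twist on \<open>Q\<close> kills those on \<open>P\<close>, so the same
      argument runs with \<open>P\<close> and \<open>Q\<close> exchanged.\<close>
    then have "toric_pair (m j) (v q) = 0" if "j \<in> P - {p}" for j
      using one_twist_vanishes[OF split pq m] that by blast
    then show ?thesis
      using untwisted_not_ch4_positive[OF splitting_sym[OF split] pq(2,1) dual_frame_sym[OF m]] assms
      by blast
  qed
qed

end

theorem theorem4p4:
  fixes v :: "nat \<Rightarrow> int^'d" and F :: "nat set set" and n :: nat
    and deg :: "nat multiset \<Rightarrow> rat"
  assumes "CARD('d) \<ge> 5"
    and "smooth_complete_fan n v F"
    and "n = CARD('d) + 2"
    and "toric_degree n v F deg"
  shows "\<not> ch_positive n v F deg 4"
proof -
  interpret rank_two_fan n v F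
    by unfold_locales (use assms in auto)
  show ?thesis
    using not_ch4_positive[OF assms(4,1)] .
qed

end
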